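(* For every integer $n\ge 4$, $$g_n\le \frac{4}{n}\cdot\sin^2\left(\frac{2\pi}{n}\right).$$
   Context: $\Delta(\cdot)$ denotes area in the Euclidean plane. For an integer $n\ge 4$, define $$g_n=\max\ \min_{1\le k\le n}\frac{\Delta(A_{k-1}A_kA_{k+1})}{\Delta(A_1A_2\ldots A_n)},$$ where the maximum is taken over all convex $n$-gons $A_1A_2\ldots A_n$ in the plane (vertices listed in cyclic order), and vertex indices are taken modulo $n$ (so $A_0=A_n$ and $A_{n+1}=A_1$). *)

theory Defs
  imports "HOL-Analysis.Analysis"
begin

text \<open>
  The vertices are \<open>A 1, \<dots>, A n\<close>; the values at \<open>0\<close> and \<open>n + 1\<close> implement the convention
  that indices are taken modulo \<open>n\<close>. Convexity is meant strictly: the vertices are distinct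
  and are precisely the corners of their convex hull. They are in cyclic order (of
  either orientation) because consecutive vertices are joined by edges of the hull.
\<close>

definition convex_ngon :: "nat \<Rightarrow> (nat \<Rightarrow> real^2) \<Rightarrow> bool" where
  "convex_ngon n A \<longleftrightarrow>
     n \<ge> 3 \<and> A 0 = A n \<and> A (n + 1) = A 1 \<and>
     inj_on A {1..n} \<and>
     {x. x extreme_point_of (convex hull (A ` {1..n}))} = A ` {1..n} \<and>
     (\<forall>k\<in>{1..n}. closed_segment (A k) (A (k + 1)) edge_of (convex hull (A ` {1..n})))"

text \<open>The region bounded by a convex polygon is the convex hull of its vertices.\<close>

definition min_ear_ratio :: "nat \<Rightarrow> (nat \<Rightarrow> real^2) \<Rightarrow> real" where
  "min_ear_ratio n A =
     (MIN k\<in>{1..n}. measure lborel (convex hull {A (k - 1), A k, A (k + 1)})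
                      / measure lborel (convex hull (A ` {1..n})))"

text \<open>
  The maximum is rendered as a supremum of real numbers (the ratios lie between \<open>0\<close> and
  \<open>1\<close>); by \<open>g_eq_maximum\<close> below it is the maximum whenever the latter is attained.
\<close>

definition g :: "nat \<Rightarrow> real" where
  "g n = (SUP A\<in>{A. convex_ngon n A}. min_ear_ratio n A)"

lemma g_eq_maximum:
  assumes "convex_ngon n A"
    and "\<And>B. convex_ngon n B \<Longrightarrow> min_ear_ratio n B \<le> min_ear_ratio n A"
  shows "g n = min_ear_ratio n A"
  unfolding g_def using assms by (intro cSup_eq_maximum) auto

end

theory Submission
  imports Defs
begin

text \<open>
  The bound that is proved is \<open>64 / n\<^sup>3\<close>; Jordan's inequality \<open>sin x \<ge> 2 x / \<pi>\<close> on
  \<open>[0, \<pi>/2]\<close>, applied to \<open>x = 2 \<pi> / n\<close>, turns it into the claim. Let \<open>e\<^sub>k = A\<^sub>k\<^sub>+\<^sub>1 - A\<^sub>k\<close> be the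
  edge vectors and write \<open>v \<and> w\<close> for the determinant of two vectors. The ear at \<open>A\<^sub>k\<close> has area
  \<open>e\<^sub>k\<^sub>-\<^sub>1 \<and> e\<^sub>k / 2\<close> for a suitable orientation of the plane. Given any norm \<open>h\<close>, with unit disc
  \<open>D\<close>, there is the identity

  \<open>e\<^sub>k\<^sub>-\<^sub>1 \<and> e\<^sub>k = h(e\<^sub>k\<^sub>-\<^sub>1) \<cdot> h(e\<^sub>k) \<cdot> d\<^sub>k\<close>,
  where \<open>d\<^sub>k\<close> is twice the area of the triangle \<open>0, e\<^sub>k\<^sub>-\<^sub>1 / h(e\<^sub>k\<^sub>-\<^sub>1), e\<^sub>k / h(e\<^sub>k)\<close>.

  The number \<open>d\<^sub>k\<close> plays the role of the sine of the exterior angle. The directions in the cone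
  spanned by \<open>e\<^sub>k\<^sub>-\<^sub>1\<close> and \<open>e\<^sub>k\<close> are those of the supporting lines that touch the polygon only at
  \<open>A\<^sub>k\<close>. So these triangles have disjoint interiors; as they lie in \<open>D\<close>, the sum of the \<open>d\<^sub>k\<close> is
  at most twice the area of \<open>D\<close> (\<open>sum_normalized_turns_le\<close>). If \<open>\<ell>\<close> is the sum of the \<open>h(e\<^sub>k)\<close>,
  the inequality of the arithmetic and geometric means yields an index \<open>k\<close> with
  \<open>e\<^sub>k\<^sub>-\<^sub>1 \<and> e\<^sub>k \<le> \<ell>\<^sup>2 \<cdot> 2 area(D) / n\<^sup>3\<close>.

  It remains to choose the norm. Let \<open>L\<close> and \<open>R\<close> be a leftmost and a rightmost vertex, and use
  as coordinates the abscissa and the linear functional with kernel \<open>R - L\<close> that has coefficient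
  \<open>1\<close> at the ordinate; this change of coordinates is a shear, hence keeps areas. Let \<open>a\<close> and
  \<open>b\<close> be the widths of the polygon in the two coordinates. It contains two triangles over the
  common base \<open>LR\<close> whose heights add up to \<open>b\<close>, so its area is at least \<open>a b / 2\<close>
  (\<open>half_box_le_area\<close>). For the taxicab norm \<open>h(v) = |x| / a + |y| / b\<close> the disc has area
  \<open>2 a b\<close> (\<open>diamond_cover\<close>), and \<open>\<ell> \<le> 4\<close>: each coordinate runs from its minimum to its
  maximum and back just once along a convex polygon (\<open>sum_abs_projection_le\<close>). The smallest ear
  thus has area at most \<open>16 \<cdot> 4 a b / (2 n\<^sup>3) = 32 a b / n\<^sup>3\<close>, which is at most
  \<open>64 / n\<^sup>3\<close> times the area of the polygon.

  Both global facts about convexity, \<open>\<ell> \<le> 4\<close> and the disjoint cones, are derived from one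
  property: all vertices lie on the same side of every edge line.
\<close>

section \<open>Areas in the plane\<close>

definition wedge :: "real^2 \<Rightarrow> real^2 \<Rightarrow> real" where
  "wedge v w = v$1 * w$2 - v$2 * w$1"

lemma wedge_self [simp]: "wedge v v = 0"
  by (simp add: wedge_def)

lemma wedge_zero_left [simp]: "wedge 0 w = 0"
  by (simp add: wedge_def)

lemma wedge_zero_right [simp]: "wedge v 0 = 0"
  by (simp add: wedge_def)

lemma wedge_add_left: "wedge (u + v) w = wedge u w + wedge v w"
  by (simp add: wedge_def algebra_simps)

lemma wedge_add_right: "wedge u (v + w) = wedge u v + wedge u w"
  by (simp add: wedge_def algebra_simps)

lemma wedge_diff_right: "wedge u (v - w) = wedge u v - wedge u w"
  by (simp add: wedge_def algebra_simps)

lemma wedge_scale_left: "wedge (c *\<^sub>R v) w = c * wedge v w"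
  by (simp add: wedge_def algebra_simps)

lemma wedge_scale_right: "wedge v (c *\<^sub>R w) = c * wedge v w"
  by (simp add: wedge_def algebra_simps)

lemma inner_real2: "v \<bullet> w = v$1 * w$1 + v$2 * w$2" for v w :: "real^2"
  by (simp add: inner_vec_def sum_2)

lemma content_triangle_wedge:
  "measure lborel (convex hull {A, B, C}) = \<bar>wedge (B - A) (C - A)\<bar> / 2"
  unfolding content_triangle wedge_def by (simp add: abs_minus_commute mult.commute)

lemma measure_lebesgue_compact:
  fixes S :: "'a::euclidean_space set"
  assumes "compact S"
  shows "measure lebesgue S = measure lborel S"
  using assms by (simp add: measure_completion borel_compact)

text \<open>
  The frontier of a convex set is negligible, so disjointness of the interiors suffices for areas
  to add up. The proof packs triangles into a disc, two triangles into a polygon, and intervals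
  into an interval.
\<close>

lemma content_packing_le:
  fixes F :: "'i \<Rightarrow> 'a::euclidean_space set"
  assumes "finite I"
    and F: "\<And>i. i \<in> I \<Longrightarrow> convex (F i)" "\<And>i. i \<in> I \<Longrightarrow> compact (F i)"
    and disj: "\<And>i j. \<lbrakk>i \<in> I; j \<in> I; i \<noteq> j\<rbrakk> \<Longrightarrow> interior (F i) \<inter> interior (F j) = {}"
    and S: "compact S" "\<And>i. i \<in> I \<Longrightarrow> F i \<subseteq> S"
  shows "(\<Sum>i\<in>I. measure lborel (F i)) \<le> measure lborel S"
proof -
  have meas: "F i \<in> lmeasurable" if "i \<in> I" for i
    using F that by (simp add: lmeasurable_compact)
  have negl: "negligible (F i \<inter> F j)" if "i \<in> I" "j \<in> I" "i \<noteq> j" for i j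
  proof (rule negligible_subset)
    show "negligible (frontier (F i) \<union> frontier (F j))"
      using F that by (intro negligible_Un negligible_convex_frontier) auto
    show "F i \<inter> F j \<subseteq> frontier (F i) \<union> frontier (F j)"
      using disj[OF that] closure_subset by (fastforce simp: frontier_def)
  qed
  have "(\<Sum>i\<in>I. measure lborel (F i)) = (\<Sum>i\<in>I. measure lebesgue (F i))"
    using F by (simp add: measure_lebesgue_compact)
  also have "\<dots> = measure lebesgue (\<Union>(F ` I))"
    using measure_negligible_finite_Union_image[OF \<open>finite I\<close>, of F] meas negl
    by (simp add: pairwise_def)
  also have "\<dots> \<le> measure lebesgue S"
    using S meas \<open>finite I\<close>
    by (intro measure_mono_fmeasurable)
       (auto simp: lmeasurable_compact intro!: fmeasurableD fmeasurable.finite_UN)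
  also have "\<dots> = measure lborel S"
    using S by (simp add: measure_lebesgue_compact)
  finally show ?thesis .
qed

lemma interior_triangle_at_origin:
  assumes "wedge v w \<noteq> 0" "u \<in> interior (convex hull {0, v, w})"
  obtains y z where "0 < y" "0 < z" "u = y *\<^sub>R v + z *\<^sub>R w"
proof -
  have "\<not> collinear {0, v, w}"
    using assms(1) by (auto simp: collinear_lemma wedge_scale_right)
  then have "\<exists>x y z. 0 < x \<and> 0 < y \<and> 0 < z \<and> x + y + z = 1 \<and> x *\<^sub>R 0 + y *\<^sub>R v + z *\<^sub>R w = u"
    using assms(2) by (subst (asm) interior_convex_hull_3_minimal) auto
  then show ?thesis
    using that by auto
qed

section \<open>Existence of convex polygons\<close>

lemma face_of_convex_hull_linear_minimum:
  fixes S :: "'a::euclidean_space set"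
  assumes "finite S" "T \<subseteq> S"
    and "\<And>x. x \<in> T \<Longrightarrow> c \<bullet> x = m" "\<And>x. x \<in> S - T \<Longrightarrow> m < c \<bullet> x"
  shows "convex hull T face_of convex hull S"
proof (rule face_of_convex_hulls)
  have "affine hull T \<subseteq> {x. c \<bullet> x = m}"
    using assms by (intro hull_minimal) (auto simp: affine_hyperplane)
  moreover have "convex hull (S - T) \<subseteq> {x. m < c \<bullet> x}"
    using assms by (intro hull_minimal) (auto simp: convex_halfspace_gt)
  ultimately show "affine hull T \<inter> convex hull (S - T) = {}"
    by fastforce
qed (use assms in auto)

text \<open>
  The supremum that defines \<open>g n\<close> is bounded by an upper bound of its elements only if there is
  at least one convex \<open>n\<close>-gon. The points \<open>(k, k\<^sup>2)\<close> on a parabola form one.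
\<close>

definition parabola_point :: "nat \<Rightarrow> real^2" where
  "parabola_point k = vector [real k, (real k)\<^sup>2]"

definition parabola_polygon :: "nat \<Rightarrow> nat \<Rightarrow> real^2" where
  "parabola_polygon n k = parabola_point (if k = 0 then n else if k = n + 1 then 1 else k)"

lemma parabola_polygon_eq: "k \<in> {1..n} \<Longrightarrow> parabola_polygon n k = parabola_point k"
  by (auto simp: parabola_polygon_def)

lemma inner_parabola_point: "vector [a, b] \<bullet> parabola_point j = a * real j + b * (real j)\<^sup>2"
  by (simp add: inner_real2 parabola_point_def)

lemma inj_parabola_point: "inj parabola_point"
proof (rule injI)
  fix i j assume "parabola_point i = parabola_point j"
  then have "parabola_point i $ 1 = parabola_point j $ 1" by simp
  then show "i = j" by (simp add: parabola_point_def)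
qed

text \<open>
  Up to an additive constant, the functional \<open>b (y - (i + j) x)\<close> has at the point \<open>(l, l\<^sup>2)\<close> the
  value \<open>b (l - i) (l - j)\<close>. For neighbours \<open>i, j\<close> this is positive at the other points if
  \<open>b = 1\<close>, and for the two end points of the chain if \<open>b = -1\<close>.
\<close>

lemma edge_of_parabola_polygon:
  assumes "i \<in> {1..n}" "j \<in> {1..n}" "i \<noteq> j"
    and "\<And>l. l \<in> {1..n} - {i, j} \<Longrightarrow> 0 < b * ((real l - real i) * (real l - real j))"
  shows "closed_segment (parabola_point i) (parabola_point j) edge_of
           (convex hull (parabola_point ` {1..n}))"
  unfolding edge_of_def
proof
  let ?c = "vector [- b * (real i + real j), b] :: real^2"
  have val: "?c \<bullet> parabola_point l + b * real i * real j = b * ((real l - real i) * (real l - real j))" for l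
    unfolding inner_parabola_point by (simp add: algebra_simps power2_eq_square)
  have "convex hull {parabola_point i, parabola_point j} face_of convex hull (parabola_point ` {1..n})"
  proof (rule face_of_convex_hull_linear_minimum[where c = ?c and m = "- b * real i * real j"])
    show "?c \<bullet> x = - b * real i * real j" if "x \<in> {parabola_point i, parabola_point j}" for x
      using that val[of i] val[of j] by auto
    show "- b * real i * real j < ?c \<bullet> x"
      if x: "x \<in> parabola_point ` {1..n} - {parabola_point i, parabola_point j}" for x
    proof -
      obtain l where "x = parabola_point l" "l \<in> {1..n} - {i, j}"
        using x by blast
      then show ?thesis
        using assms(4)[of l] val[of l] by simp
    qed
  qed (use assms in auto)
  then show "closed_segment (parabola_point i) (parabola_point j) face_of
      (convex hull (parabola_point ` {1..n}))"
    by (simp add: segment_convex_hull)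
  show "aff_dim (closed_segment (parabola_point i) (parabola_point j)) = 1"
    using assms(3) inj_parabola_point by (simp add: segment_convex_hull aff_dim_convex_hull inj_eq)
qed

lemma convex_ngon_parabola_polygon:
  assumes "n \<ge> 3"
  shows "convex_ngon n (parabola_polygon n)"
proof -
  let ?P = "parabola_point ` {1..n}"
  have img: "parabola_polygon n ` {1..n} = ?P"
    by (intro image_cong) (auto simp: parabola_polygon_eq)
  have "parabola_point k extreme_point_of convex hull ?P" if "k \<in> {1..n}" for k
  proof -
    \<comment> \<open>The tangent of the parabola touches the polygon only at its point of contact.\<close>
    let ?c = "vector [- 2 * real k, 1] :: real^2"
    have val: "?c \<bullet> parabola_point l + (real k)\<^sup>2 = (real l - real k)\<^sup>2" for l
      unfolding inner_parabola_point by (simp add: algebra_simps power2_eq_square)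
    have "convex hull {parabola_point k} face_of convex hull ?P"
    proof (rule face_of_convex_hull_linear_minimum[where c = ?c and m = "- (real k)\<^sup>2"])
      show "- (real k)\<^sup>2 < ?c \<bullet> x" if x: "x \<in> ?P - {parabola_point k}" for x
      proof -
        obtain l where l: "x = parabola_point l" "l \<noteq> k"
          using x by auto
        then have "0 < (real l - real k)\<^sup>2"
          by simp
        then show ?thesis
          unfolding l(1) using val[of l] by linarith
      qed
      show "?c \<bullet> x = - (real k)\<^sup>2" if "x \<in> {parabola_point k}" for x
        using that val[of k] by simp
    qed (use that in auto)
    then show ?thesis
      by (simp add: face_of_singleton)
  qed
  then have "{x. x extreme_point_of convex hull ?P} = ?P"
    using extreme_point_of_convex_hull by blast
  moreover have "closed_segment (parabola_polygon n k) (parabola_polygon n (k + 1)) edge_of convex hull ?P"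
    if k: "k \<in> {1..n}" for k
  proof (cases "k = n")
    case True
    have "closed_segment (parabola_point n) (parabola_point 1) edge_of convex hull ?P"
      using assms
      by (intro edge_of_parabola_polygon[where b = "-1"]) (auto intro!: mult_neg_pos)
    then show ?thesis
      using True assms by (simp add: parabola_polygon_def)
  next
    case False
    have "closed_segment (parabola_point k) (parabola_point (k + 1)) edge_of convex hull ?P"
    proof (intro edge_of_parabola_polygon[where b = 1])
      fix l assume "l \<in> {1..n} - {k, k + 1}"
      then have "l < k \<or> k + 1 < l" by auto
      then show "0 < 1 * ((real l - real k) * (real l - real (k + 1)))"
        by (auto intro: mult_pos_pos mult_neg_neg)
    qed (use k False in auto)
    then show ?thesis
      using k False by (simp add: parabola_polygon_def)
  qed
  moreover have "inj_on (parabola_polygon n) {1..n}"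
    using inj_parabola_point by (auto simp: inj_on_def parabola_polygon_eq)
  ultimately show ?thesis
    using assms unfolding convex_ngon_def img by (simp add: parabola_polygon_def)
qed

section \<open>Elementary inequalities\<close>

lemma jordan_sin_ge:
  fixes x :: real
  assumes "0 \<le> x" "x \<le> pi / 2"
  shows "2 / pi * x \<le> sin x"
proof -
  have "concave_on {0..pi/2} sin"
  proof (rule f''_le0_imp_concave[where f' = cos and f'' = "\<lambda>x. - sin x"])
    show "- sin x \<le> 0" if "x \<in> {0..pi/2}" for x :: real
      using that by (auto intro: sin_ge_zero)
  qed (auto intro!: derivative_eq_intros)
  from concave_onD_Icc'[OF this, of x] show ?thesis
    using assms by simp
qed

text \<open>
  This is the inequality of the arithmetic and geometric means for three numbers, in the form
  in which it can be summed over all vertices.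
\<close>

lemma prod3_gt_1_imp_sum3_gt_3:
  fixes x y z :: real
  assumes "0 < x" "0 < y" "0 < z" "1 < x * y * z"
  shows "3 < x + y + z"
proof -
  have "0 < ln (x * y * z)"
    using assms by simp
  also have "\<dots> = ln x + ln y + ln z"
    using assms by (simp add: ln_mult)
  also have "\<dots> \<le> (x - 1) + (y - 1) + (z - 1)"
    using assms by (intro add_mono ln_le_minus_one)
  finally show ?thesis by simp
qed

lemma finite_attains_min:
  fixes f :: "'a \<Rightarrow> real"
  assumes "finite S" "S \<noteq> {}"
  obtains x where "x \<in> S" "\<And>y. y \<in> S \<Longrightarrow> f x \<le> f y"
proof -
  have "Min (f ` S) \<in> f ` S"
    using assms by simp
  then obtain x where "x \<in> S" "f x = Min (f ` S)"
    by force
  then show ?thesis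
    using that[of x] assms by simp
qed

section \<open>A sheared box and its diamond\<close>

text \<open>
  The expansion of \<open>v \<and> w\<close> in the orthogonal frame given by \<open>c\<close>: if \<open>w\<close> is orthogonal to \<open>c\<close>,
  then \<open>v \<and> w\<close> is a multiple of \<open>c \<and> w\<close>, and the sign of the factor is the sign of \<open>c \<bullet> v\<close>.
\<close>

lemma wedge_mult_inner:
  "wedge v w * (c \<bullet> c) = (c \<bullet> v) * wedge c w - (c \<bullet> w) * wedge c v"
  unfolding wedge_def inner_real2 by algebra

text \<open>The map \<open>v \<mapsto> (v$1, c \<bullet> v)\<close> is a shear, so the determinant may be computed after it.\<close>

lemma wedge_shear:
  assumes "c $ 2 = 1"
  shows "wedge v w = v$1 * (c \<bullet> w) - (c \<bullet> v) * w$1"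
  using assms by (simp add: wedge_def inner_real2 algebra_simps)

text \<open>
  The level line of \<open>c\<close> through \<open>p\<close> and \<open>q\<close> separates the triangles \<open>p q t\<close> and \<open>p q b\<close>; in the
  sheared coordinates they have the common base \<open>q$1 - p$1\<close> and the heights \<open>c \<bullet> t - m\<close> and
  \<open>m - c \<bullet> b\<close>.
\<close>

lemma half_box_le_area:
  fixes V :: "(real^2) set" and c :: "real^2"
  assumes V: "finite V" "{p, q, t, b} \<subseteq> V" and c: "c $ 2 = 1"
    and level: "c \<bullet> p = m" "c \<bullet> q = m" "c \<bullet> b \<le> m" "m \<le> c \<bullet> t" and "p$1 \<le> q$1"
  shows "(q$1 - p$1) * (c \<bullet> t - c \<bullet> b) / 2 \<le> measure lborel (convex hull V)"
proof -
  define F where "F = (\<lambda>up. if up then convex hull {p, q, t} else convex hull {p, q, b})"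
  have "c \<noteq> 0"
    using c by auto
  have up: "F True \<subseteq> {x. m \<le> c \<bullet> x}"
    unfolding F_def using level by simp (intro hull_minimal convex_halfspace_ge; auto)
  have down: "F False \<subseteq> {x. c \<bullet> x \<le> m}"
    unfolding F_def using level by simp (intro hull_minimal convex_halfspace_le; auto)
  have "interior (F True) \<inter> interior (F False) = {}"
    using interior_mono[OF up] interior_mono[OF down] \<open>c \<noteq> 0\<close>
    by (simp add: interior_halfspace_ge interior_halfspace_le) fastforce
  then have "(\<Sum>i\<in>UNIV. measure lborel (F i)) \<le> measure lborel (convex hull V)"
  proof (intro content_packing_le)
    fix i j :: bool
    assume "interior (F True) \<inter> interior (F False) = {}" "i \<noteq> j"
    then show "interior (F i) \<inter> interior (F j) = {}"
      by (cases i; cases j) auto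
  next
    show "F i \<subseteq> convex hull V" for i
      using V by (auto simp: F_def intro!: hull_mono)
  qed (use V in \<open>auto simp: F_def intro!: finite_imp_compact_convex_hull\<close>)
  moreover have "measure lborel (F True) = (q$1 - p$1) * (c \<bullet> t - m) / 2"
    using level \<open>p$1 \<le> q$1\<close>
    by (simp add: F_def content_triangle_wedge wedge_shear[OF c] inner_diff_right abs_mult)
  moreover have "measure lborel (F False) = (q$1 - p$1) * (m - c \<bullet> b) / 2"
    using level \<open>p$1 \<le> q$1\<close>
    by (simp add: F_def content_triangle_wedge wedge_shear[OF c] inner_diff_right abs_mult)
  ultimately show ?thesis
    by (simp add: UNIV_bool field_simps)
qed

text \<open>
  In the sheared coordinates, the diamond with half diagonals \<open>a\<close> and \<open>b\<close> is cut by a diagonal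
  into two triangles of area \<open>a b\<close>.
\<close>

lemma diamond_cover:
  fixes c :: "real^2"
  assumes c: "c $ 2 = 1" and "0 < a" "0 < b"
  obtains D where "compact D" "{v. \<bar>v$1\<bar> / a + \<bar>c \<bullet> v\<bar> / b \<le> 1} \<subseteq> D" "measure lborel D \<le> 2 * a * b"
proof
  define p :: "real^2" where "p = vector [a, - c$1 * a]"
  define q :: "real^2" where "q = vector [0, b]"
  define U where "U = convex hull {p, q, - p}"
  define U' where "U' = convex hull {p, - q, - p}"
  have comp: "compact U" "compact U'"
    unfolding U_def U'_def by (auto intro!: finite_imp_compact_convex_hull)
  then show "compact (U \<union> U')"
    by (rule compact_Un)
  have "measure lborel U = a * b" "measure lborel U' = a * b"
    using assms by (simp_all add: U_def U'_def content_triangle_wedge wedge_def p_def q_def algebra_simps)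
  moreover have "measure lborel (U \<union> U') \<le> measure lborel U + measure lborel U'"
    using comp by (intro measure_Un_le) (auto simp: borel_compact)
  ultimately show "measure lborel (U \<union> U') \<le> 2 * a * b"
    by simp
  show "{v. \<bar>v$1\<bar> / a + \<bar>c \<bullet> v\<bar> / b \<le> 1} \<subseteq> U \<union> U'"
  proof safe
    fix v assume v: "\<bar>v$1\<bar> / a + \<bar>c \<bullet> v\<bar> / b \<le> 1" "v \<notin> U'"
    define x y where "x = v$1 / a" and "y = (c \<bullet> v) / b"
    have le: "\<bar>x\<bar> + \<bar>y\<bar> \<le> 1"
      using v \<open>0 < a\<close> \<open>0 < b\<close> by (simp add: x_def y_def abs_divide)
    have eq: "v = x *\<^sub>R p + y *\<^sub>R q"
      using assms by (simp add: vec_eq_iff forall_2 p_def q_def x_def y_def inner_real2 field_simps)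
    have mem: "x *\<^sub>R p + z *\<^sub>R r \<in> convex hull {p, r, - p}" if "0 \<le> z" "\<bar>x\<bar> + z \<le> 1" for z r
    proof -
      have "x *\<^sub>R p + z *\<^sub>R r = ((1 - z + x) / 2) *\<^sub>R p + z *\<^sub>R r + ((1 - z - x) / 2) *\<^sub>R (- p)"
        by (simp add: vec_eq_iff field_simps)
      moreover have "0 \<le> (1 - z + x) / 2" "0 \<le> (1 - z - x) / 2" "(1 - z + x) / 2 + z + (1 - z - x) / 2 = 1"
        using that by (auto simp: field_simps)
      ultimately show ?thesis
        unfolding convex_hull_3 using that by blast
    qed
    have "0 \<le> y"
    proof (rule ccontr)
      assume "\<not> 0 \<le> y"
      then have "v \<in> U'"
        using mem[of "- y" "- q"] le by (simp add: U'_def eq)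
      with v show False by simp
    qed
    then show "v \<in> U"
      using mem[of y q] le by (simp add: U_def eq)
  qed
qed

section \<open>Edges and vertices of an oriented polygon\<close>

text \<open>
  The number \<open>s\<close> is the orientation, \<open>1\<close> if the vertices run anticlockwise and \<open>-1\<close> otherwise;
  multiplying determinants by it treats both cases at once.
\<close>

locale oriented_polygon =
  fixes n :: nat and A :: "nat \<Rightarrow> real^2" and s :: real
  assumes three_le: "3 \<le> n" and wrap_0: "A 0 = A n" and wrap_Suc: "A (n + 1) = A 1"
    and inj: "inj_on A {1..n}" and orientation: "\<bar>s\<bar> = 1"
    and left_of_edge':
      "\<lbrakk>k \<in> {1..n}; j \<in> {1..n}; A j \<noteq> A k; A j \<noteq> A (k + 1)\<rbrakk>
         \<Longrightarrow> 0 < s * wedge (A (k + 1) - A k) (A j - A k)"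
begin

definition edge :: "nat \<Rightarrow> real^2" where
  "edge k = A (k + 1) - A k"

lemma edge_0: "edge 0 = edge n"
  using wrap_0 wrap_Suc by (simp add: edge_def)

lemma vertex_index:
  assumes "k \<le> n + 1"
  obtains j where "j \<in> {1..n}" "A k = A j"
proof (cases "k = 0 \<or> k = n + 1")
  case True
  then show ?thesis
    using that[of n] that[of 1] wrap_0 wrap_Suc three_le by auto
next
  case False
  then show ?thesis
    using that[of k] assms by auto
qed

lemma vertex_eq_iff: "\<lbrakk>i \<in> {1..n}; j \<in> {1..n}\<rbrakk> \<Longrightarrow> A i = A j \<longleftrightarrow> i = j"
  using inj by (auto dest: inj_onD)

lemma left_of_edge:
  assumes "k \<le> n" "j \<le> n + 1" "A j \<noteq> A k" "A j \<noteq> A (k + 1)"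
  shows "0 < s * wedge (edge k) (A j - A k)"
proof -
  obtain i where i: "i \<in> {1..n}" "A j = A i"
    using vertex_index[OF assms(2)] .
  show ?thesis
  proof (cases "k = 0")
    case True
    then have "0 < s * wedge (A (n + 1) - A n) (A i - A n)"
      using assms i three_le wrap_0 wrap_Suc by (intro left_of_edge') auto
    then show ?thesis
      using True i wrap_0 wrap_Suc by (simp add: edge_def)
  next
    case False
    then show ?thesis
      using left_of_edge'[of k i] assms i by (simp add: edge_def)
  qed
qed

lemma left_of_edge_weak:
  assumes "k \<le> n" "j \<le> n + 1"
  shows "0 \<le> s * wedge (edge k) (A j - A k)"
proof (cases "A j = A k \<or> A j = A (k + 1)")
  case True
  then show ?thesis by (auto simp: edge_def)
next
  case False
  then show ?thesis
    using left_of_edge[OF assms] by auto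
qed

lemma neighbours_distinct:
  assumes "k \<in> {1..n}"
  shows "A (k + 1) \<noteq> A k" "A (k + 1) \<noteq> A (k - 1)" "A (k - 1) \<noteq> A k"
proof -
  have *: "A (k + 1) = A (if k = n then 1 else k + 1)" "A (k - 1) = A (if k = 1 then n else k - 1)"
    using wrap_0 wrap_Suc by auto
  show "A (k + 1) \<noteq> A k" "A (k + 1) \<noteq> A (k - 1)" "A (k - 1) \<noteq> A k"
    unfolding * using assms three_le by (subst vertex_eq_iff; auto split: if_splits)+
qed

lemma turn_pos:
  assumes "k \<in> {1..n}"
  shows "0 < s * wedge (edge (k - 1)) (edge k)"
proof -
  have "0 < s * wedge (edge (k - 1)) (A (k + 1) - A (k - 1))"
    using assms neighbours_distinct[OF assms] by (intro left_of_edge) auto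
  moreover have "A (k + 1) - A (k - 1) = edge k + edge (k - 1)"
    using assms by (simp add: edge_def)
  ultimately show ?thesis
    by (simp add: wedge_add_right)
qed

lemma ear_area:
  assumes "k \<in> {1..n}"
  shows "measure lborel (convex hull {A (k - 1), A k, A (k + 1)})
           = s * wedge (edge (k - 1)) (edge k) / 2"
proof -
  have "A k - A (k - 1) = edge (k - 1)" "A (k + 1) - A (k - 1) = edge k + edge (k - 1)"
    using assms by (simp_all add: edge_def)
  then have "measure lborel (convex hull {A (k - 1), A k, A (k + 1)})
      = \<bar>s * wedge (edge (k - 1)) (edge k)\<bar> / 2"
    by (simp add: content_triangle_wedge wedge_add_right abs_mult orientation)
  then show ?thesis
    using turn_pos[OF assms] by simp
qed

lemma sum_previous_edge: "(\<Sum>k=1..n. f (edge (k - 1))) = (\<Sum>k=1..n. f (edge k) :: real)"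
proof -
  have "(\<Sum>k=Suc 0..n. f (edge k) - f (edge (k - 1))) = f (edge n) - f (edge 0)"
    by (rule sum_telescope'') simp
  then show ?thesis
    by (simp add: sum_subtractf edge_0)
qed

lemma not_on_line:
  assumes "c \<noteq> 0"
  shows "\<exists>j\<in>{1..n}. c \<bullet> A j \<noteq> m"
proof (rule ccontr)
  assume "\<not> ?thesis"
  then have level: "c \<bullet> A j = m" if "j \<le> n + 1" for j
    using vertex_index[OF that] by metis
  have "c \<bullet> edge 0 = 0" "c \<bullet> edge 1 = 0"
    using three_le by (simp_all add: edge_def inner_diff_right level)
  then have "wedge (edge 0) (edge 1) = 0"
    using wedge_mult_inner[of "edge 0" "edge 1" c] assms by simp
  with turn_pos[of 1] three_le show False by simp
qed

text \<open>
  Suppose that two edges on which \<open>c\<close> increases both contain a point of level \<open>t\<close>. Each of these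
  points lies on the polygon's side of the line of the other edge, and along the level line this
  side is in the same direction for both edges. So the two points agree, and then an inner point of one edge
  lies on the line of the other, which forces the edges to have the same end points.
\<close>

lemma rising_edges_disjoint:
  assumes kj: "k \<in> {1..n}" "j \<in> {1..n}" "k \<noteq> j"
    and k: "c \<bullet> A k < t" "t < c \<bullet> A (k + 1)" and j: "c \<bullet> A j < t" "t < c \<bullet> A (j + 1)"
  shows False
proof -
  have pos: "0 < c \<bullet> edge k" "0 < c \<bullet> edge j"
    using k j by (auto simp: edge_def inner_diff_right)
  then have "0 < c \<bullet> c"
    by auto
  define x where "x = (t - c \<bullet> A k) / (c \<bullet> edge k)"
  define y where "y = (t - c \<bullet> A j) / (c \<bullet> edge j)"
  \<comment> \<open>The vector \<open>w\<close> joins the points of level \<open>t\<close> on the edges \<open>k\<close> and \<open>j\<close>.\<close>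
  define w where "w = (A j + y *\<^sub>R edge j) - (A k + x *\<^sub>R edge k)"
  have x: "0 < x" "x < 1"
    using k pos by (auto simp: x_def edge_def inner_diff_right)
  have y: "0 < y" "y < 1"
    using j pos by (auto simp: y_def edge_def inner_diff_right)
  have cw: "c \<bullet> w = 0"
    using pos by (simp add: w_def x_def y_def inner_add_right inner_diff_right)
  define r where "r i = (c \<bullet> edge i) / (c \<bullet> c)" for i
  have parallel: "s * wedge (edge i) w = r i * (s * wedge c w)" for i
    using wedge_mult_inner[of "edge i" w c] cw \<open>0 < c \<bullet> c\<close> by (simp add: r_def field_simps)
  have r: "0 < r k" "0 < r j"
    using pos \<open>0 < c \<bullet> c\<close> by (simp_all only: r_def divide_pos_pos)
  have above: "s * wedge (edge i) (A i' + z *\<^sub>R edge i' - A i) =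
      (1 - z) * (s * wedge (edge i) (A i' - A i)) + z * (s * wedge (edge i) (A (i' + 1) - A i))" for i i' z
    by (simp add: wedge_def edge_def algebra_simps)
  have "0 \<le> s * wedge (edge k) (A j + y *\<^sub>R edge j - A k)"
    unfolding above using y kj by (intro add_nonneg_nonneg mult_nonneg_nonneg left_of_edge_weak) auto
  also have "wedge (edge k) (A j + y *\<^sub>R edge j - A k) = wedge (edge k) w"
    by (simp add: w_def wedge_add_right wedge_diff_right wedge_scale_right)
  finally have "0 \<le> r k * (s * wedge c w)"
    by (simp only: parallel)
  then have 1: "0 \<le> s * wedge c w"
    using r(1) by (simp only: zero_le_mult_iff) linarith
  have terms: "0 \<le> (1 - x) * (s * wedge (edge j) (A k - A j))" "0 \<le> x * (s * wedge (edge j) (A (k + 1) - A j))"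
    using x kj by (auto intro!: mult_nonneg_nonneg left_of_edge_weak)
  have eq: "wedge (edge j) (A k + x *\<^sub>R edge k - A j) = - wedge (edge j) w"
    by (simp add: w_def wedge_add_right wedge_diff_right wedge_scale_right)
  have sum: "(1 - x) * (s * wedge (edge j) (A k - A j)) + x * (s * wedge (edge j) (A (k + 1) - A j))
      = - (r j * (s * wedge c w))"
    by (simp only: above[symmetric] eq mult_minus_right parallel)
  have "0 \<le> r j * (s * wedge c w)"
    using mult_nonneg_nonneg[OF less_imp_le[OF r(2)] 1] .
  then have "(1 - x) * (s * wedge (edge j) (A k - A j)) = 0" "x * (s * wedge (edge j) (A (k + 1) - A j)) = 0"
    using sum terms by linarith+
  then have zero: "s * wedge (edge j) (A k - A j) = 0" "s * wedge (edge j) (A (k + 1) - A j) = 0"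
    using x by auto
  have "A k = A j \<or> A k = A (j + 1)" "A (k + 1) = A j \<or> A (k + 1) = A (j + 1)"
    using left_of_edge[of j k] left_of_edge[of j "k + 1"] zero kj by fastforce+
  moreover have "A k \<noteq> A j"
    using kj vertex_eq_iff by simp
  ultimately show False
    using k j by auto
qed

text \<open>
  The edges on which \<open>c\<close> increases project to intervals without common inner points, so the total
  increase is at most the width \<open>hi - lo\<close>; the total decrease equals the total increase, because
  the polygon is closed.
\<close>

lemma sum_abs_projection_le:
  assumes range: "\<And>j. j \<in> {1..n} \<Longrightarrow> lo \<le> c \<bullet> A j" "\<And>j. j \<in> {1..n} \<Longrightarrow> c \<bullet> A j \<le> hi"
  shows "(\<Sum>k=1..n. \<bar>c \<bullet> edge k\<bar>) \<le> 2 * (hi - lo)"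
proof -
  define K where "K = {k \<in> {1..n}. 0 < c \<bullet> edge k}"
  have lohi: "lo \<le> hi"
    using range[of 1] three_le by auto
  have bounds: "lo \<le> c \<bullet> A j" "c \<bullet> A j \<le> hi" if "j \<le> n + 1" for j
    using vertex_index[OF that] range by metis+
  have K: "k \<in> {1..n}" "c \<bullet> A k < c \<bullet> A (k + 1)" if "k \<in> K" for k
    using that by (auto simp: K_def edge_def inner_diff_right)
  have "(\<Sum>k=1..n. c \<bullet> edge k) = (\<Sum>k=1..n. c \<bullet> A (Suc k) - c \<bullet> A k)"
    by (simp add: edge_def inner_diff_right)
  also have "\<dots> = 0"
    using wrap_Suc by (subst sum_Suc_diff) auto
  finally have total: "(\<Sum>k=1..n. c \<bullet> edge k) = 0" .
  have "(\<Sum>k\<in>K. c \<bullet> edge k) = (\<Sum>k\<in>K. measure lborel {c \<bullet> A k .. c \<bullet> A (k + 1)})"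
    using K by (intro sum.cong refl) (force simp: edge_def inner_diff_right)
  also have "\<dots> \<le> measure lborel {lo..hi}"
  proof (rule content_packing_le)
    show "interior {c \<bullet> A k .. c \<bullet> A (k + 1)} \<inter> interior {c \<bullet> A j .. c \<bullet> A (j + 1)} = {}"
      if "k \<in> K" "j \<in> K" "k \<noteq> j" for k j
      using rising_edges_disjoint[of k j c] K that
      by (simp only: interior_atLeastAtMost_real) (meson disjoint_iff greaterThanLessThan_iff)
    show "{c \<bullet> A k .. c \<bullet> A (k + 1)} \<subseteq> {lo..hi}" if "k \<in> K" for k
      using bounds[of k] bounds[of "k + 1"] K[OF that] by auto
  qed (auto simp: K_def)
  also have "\<dots> = hi - lo"
    using lohi by simp
  finally have rising: "(\<Sum>k\<in>K. c \<bullet> edge k) \<le> hi - lo" .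
  have "(\<Sum>k=1..n. \<bar>c \<bullet> edge k\<bar>) = (\<Sum>k=1..n. 2 * (if 0 < c \<bullet> edge k then c \<bullet> edge k else 0) - c \<bullet> edge k)"
    by (intro sum.cong) auto
  also have "\<dots> = 2 * (\<Sum>k=1..n. if 0 < c \<bullet> edge k then c \<bullet> edge k else 0)"
    using total by (simp add: sum_subtractf sum_distrib_left)
  also have "(\<Sum>k=1..n. if 0 < c \<bullet> edge k then c \<bullet> edge k else 0) = (\<Sum>k\<in>K. c \<bullet> edge k)"
    unfolding K_def by (rule sum.inter_filter[symmetric]) simp
  finally show ?thesis
    using rising by simp
qed

text \<open>
  For a direction \<open>u\<close> strictly between two consecutive edges, the line through their common
  vertex with direction \<open>u\<close> supports the polygon and meets no other vertex: both edge lines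
  have all vertices on the same side, and no vertex but the common one is on both lines.
\<close>

lemma vertex_extreme_in_cone:
  assumes kj: "k \<in> {1..n}" "j \<in> {1..n}" "k \<noteq> j" and "0 < y" "0 < z"
  shows "0 < s * wedge (y *\<^sub>R edge (k - 1) + z *\<^sub>R edge k) (A j - A k)"
proof -
  have "A j - A k = (A j - A (k - 1)) - edge (k - 1)"
    using kj by (simp add: edge_def)
  then have prev: "wedge (edge (k - 1)) (A j - A k) = wedge (edge (k - 1)) (A j - A (k - 1))"
    by (metis diff_zero wedge_diff_right wedge_self)
  have "A j \<noteq> A k"
    using kj vertex_eq_iff by auto
  then consider "A j \<noteq> A (k + 1)" | "A j \<noteq> A (k - 1)"
    using neighbours_distinct[OF kj(1)] by metis
  then have "0 < s * wedge (edge (k - 1)) (A j - A k) \<or> 0 < s * wedge (edge k) (A j - A k)"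
  proof cases
    case 1
    then show ?thesis
      using left_of_edge[of k j] kj \<open>A j \<noteq> A k\<close> by auto
  next
    case 2
    then show ?thesis
      using left_of_edge[of "k - 1" j] kj \<open>A j \<noteq> A k\<close> prev by auto
  qed
  moreover have "0 \<le> s * wedge (edge (k - 1)) (A j - A k)" "0 \<le> s * wedge (edge k) (A j - A k)"
    unfolding prev using kj by (auto intro!: left_of_edge_weak)
  ultimately have "0 < y * (s * wedge (edge (k - 1)) (A j - A k)) + z * (s * wedge (edge k) (A j - A k))"
    using assms(4,5) by (auto intro: add_pos_nonneg add_nonneg_pos)
  then show ?thesis
    by (simp add: wedge_add_left wedge_scale_left algebra_simps)
qed

text \<open>
  The summands are twice the areas of triangles whose inner points are directions in the cones of
  \<open>vertex_extreme_in_cone\<close>. A direction in two such cones would be that of a line through \<open>A k\<close>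
  with \<open>A j\<close> strictly on its left and of a parallel line through \<open>A j\<close> with \<open>A k\<close> strictly on its
  left.
\<close>

lemma sum_normalized_turns_le:
  assumes h: "\<And>k. k \<le> n \<Longrightarrow> 0 < h (edge k)"
    and D: "compact D" "\<And>k. k \<in> {1..n} \<Longrightarrow>
      convex hull {0, edge (k - 1) /\<^sub>R h (edge (k - 1)), edge k /\<^sub>R h (edge k)} \<subseteq> D"
  shows "(\<Sum>k=1..n. s * wedge (edge (k - 1)) (edge k) / (h (edge (k - 1)) * h (edge k)))
           \<le> 2 * measure lborel D"
proof -
  define F where "F k = convex hull {0, edge (k - 1) /\<^sub>R h (edge (k - 1)), edge k /\<^sub>R h (edge k)}" for k
  have wedge_unit: "wedge (edge (k - 1) /\<^sub>R h (edge (k - 1))) (edge k /\<^sub>R h (edge k)) =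
      wedge (edge (k - 1)) (edge k) / (h (edge (k - 1)) * h (edge k))" for k
    by (simp add: wedge_scale_left wedge_scale_right field_simps)
  have area: "measure lborel (F k) = s * wedge (edge (k - 1)) (edge k) / (h (edge (k - 1)) * h (edge k)) / 2"
    if "k \<in> {1..n}" for k
  proof -
    have "measure lborel (F k) = \<bar>s * wedge (edge (k - 1)) (edge k) / (h (edge (k - 1)) * h (edge k))\<bar> / 2"
      using wedge_unit[of k] by (simp add: F_def content_triangle_wedge abs_mult orientation)
    also have "\<bar>s * wedge (edge (k - 1)) (edge k) / (h (edge (k - 1)) * h (edge k))\<bar> =
        s * wedge (edge (k - 1)) (edge k) / (h (edge (k - 1)) * h (edge k))"
    proof (rule abs_of_pos)
      have "0 < h (edge (k - 1))" "0 < h (edge k)"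
        using h that by auto
      then show "0 < s * wedge (edge (k - 1)) (edge k) / (h (edge (k - 1)) * h (edge k))"
        using turn_pos[OF that] by (metis divide_pos_pos mult_pos_pos)
    qed
    finally show ?thesis .
  qed
  have cone: "0 < s * wedge u (A j - A k)"
    if u: "u \<in> interior (F k)" and kj: "k \<in> {1..n}" "j \<in> {1..n}" "k \<noteq> j" for u j k
  proof -
    have hpos: "0 < h (edge (k - 1))" "0 < h (edge k)"
      using h kj by auto
    have "wedge (edge (k - 1) /\<^sub>R h (edge (k - 1))) (edge k /\<^sub>R h (edge k)) \<noteq> 0"
      using turn_pos[OF kj(1)] hpos unfolding wedge_unit by auto
    then obtain y z where "0 < y" "0 < z"
      "u = y *\<^sub>R (edge (k - 1) /\<^sub>R h (edge (k - 1))) + z *\<^sub>R (edge k /\<^sub>R h (edge k))"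
      using u unfolding F_def by (rule interior_triangle_at_origin)
    then show ?thesis
      using vertex_extreme_in_cone[OF kj, of "y / h (edge (k - 1))" "z / h (edge k)"] hpos
      by (simp add: divide_inverse)
  qed
  have "(\<Sum>k=1..n. measure lborel (F k)) \<le> measure lborel D"
  proof (rule content_packing_le)
    fix k j assume kj: "k \<in> {1..n}" "j \<in> {1..n}" "k \<noteq> j"
    show "interior (F k) \<inter> interior (F j) = {}"
    proof (rule ccontr)
      assume "interior (F k) \<inter> interior (F j) \<noteq> {}"
      then obtain u where "u \<in> interior (F k)" "u \<in> interior (F j)" by auto
      then have "0 < s * wedge u (A j - A k)" "0 < s * wedge u (A k - A j)"
        using cone kj by auto
      then show False
        by (simp add: wedge_diff_right right_diff_distrib)
    qed
  qed (use D in \<open>auto simp: F_def intro!: finite_imp_compact_convex_hull\<close>)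
  moreover have "(\<Sum>k=1..n. measure lborel (F k)) =
      (\<Sum>k=1..n. s * wedge (edge (k - 1)) (edge k) / (h (edge (k - 1)) * h (edge k))) / 2"
    unfolding sum_divide_distrib by (intro sum.cong refl) (simp add: area)
  ultimately show ?thesis by simp
qed

section \<open>The smallest ear\<close>

lemma exists_small_ear:
  "\<exists>k\<in>{1..n}. measure lborel (convex hull {A (k - 1), A k, A (k + 1)})
     \<le> 64 / real n ^ 3 * measure lborel (convex hull (A ` {1..n}))"
proof -
  let ?V = "A ` {1..n}"
  have V: "finite ?V" "?V \<noteq> {}"
    using three_le by auto
  define e1 :: "real^2" where "e1 = vector [1, 0]"
  have e1: "e1 \<bullet> v = v$1" for v
    by (simp add: e1_def inner_real2)
  obtain L where L: "L \<in> ?V" "\<And>v. v \<in> ?V \<Longrightarrow> L$1 \<le> v$1"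
    using finite_attains_min[OF V, of "\<lambda>v. v$1"] by blast
  obtain R where R: "R \<in> ?V" "\<And>v. v \<in> ?V \<Longrightarrow> v$1 \<le> R$1"
    using finite_attains_min[OF V, of "\<lambda>v. - v$1"] by (metis neg_le_iff_le)
  have "e1 \<noteq> 0"
    using e1[of "vector [1, 0]"] by auto
  then obtain i where "i \<in> {1..n}" "A i $ 1 \<noteq> L$1"
    using not_on_line[of e1 "L$1"] e1 by metis
  then have LR: "L$1 < R$1"
    using L(2)[of "A i"] R(2)[of "A i"] by auto
  define c :: "real^2" where "c = vector [- (R$2 - L$2) / (R$1 - L$1), 1]"
  have c: "c $ 2 = 1" "c \<noteq> 0"
    by (auto simp: c_def vec_eq_iff forall_2)
  have "c \<bullet> (R - L) = 0"
    using LR by (simp add: c_def inner_real2)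
  then have cLR: "c \<bullet> R = c \<bullet> L"
    by (simp add: inner_diff_right)
  obtain B where B: "B \<in> ?V" "\<And>v. v \<in> ?V \<Longrightarrow> c \<bullet> B \<le> c \<bullet> v"
    using finite_attains_min[OF V, of "\<lambda>v. c \<bullet> v"] by blast
  obtain T where T: "T \<in> ?V" "\<And>v. v \<in> ?V \<Longrightarrow> c \<bullet> v \<le> c \<bullet> T"
    using finite_attains_min[OF V, of "\<lambda>v. - (c \<bullet> v)"] by (metis neg_le_iff_le)
  obtain i where "i \<in> {1..n}" "c \<bullet> A i \<noteq> c \<bullet> B"
    using not_on_line[of c "c \<bullet> B"] c by metis
  then have BT: "c \<bullet> B < c \<bullet> T"
    using B(2)[of "A i"] T(2)[of "A i"] by auto
  define a where "a = R$1 - L$1"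
  define b where "b = c \<bullet> T - c \<bullet> B"
  have ab: "0 < a" "0 < b"
    using LR BT by (auto simp: a_def b_def)
  have area: "a * b / 2 \<le> measure lborel (convex hull ?V)"
    unfolding a_def b_def
    by (rule half_box_le_area[where m = "c \<bullet> L"]) (use L R B T c cLR LR in auto)
  define h :: "real^2 \<Rightarrow> real" where "h v = \<bar>v$1\<bar> / a + \<bar>c \<bullet> v\<bar> / b" for v
  have h_scale: "h (t *\<^sub>R v) = \<bar>t\<bar> * h v" for t v
    by (simp add: h_def abs_mult algebra_simps)
  have h_add: "h (u + v) \<le> h u + h v" for u v
  proof -
    have "\<bar>(u + v)$1\<bar> / a \<le> \<bar>u$1\<bar> / a + \<bar>v$1\<bar> / a"
      using ab by (simp add: add_divide_distrib[symmetric] divide_right_mono)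
    moreover have "\<bar>c \<bullet> (u + v)\<bar> / b \<le> \<bar>c \<bullet> u\<bar> / b + \<bar>c \<bullet> v\<bar> / b"
      using ab by (simp add: add_divide_distrib[symmetric] divide_right_mono inner_add_right)
    ultimately show ?thesis by (simp add: h_def)
  qed
  have "0 \<le> h v" for v
    using ab by (simp add: h_def)
  moreover have "h v \<noteq> 0" if "wedge u v \<noteq> 0" for u v
  proof
    assume "h v = 0"
    then have "v$1 = 0" "c \<bullet> v = 0"
      using ab by (auto simp: h_def add_nonneg_eq_0_iff)
    with that show False
      by (simp add: wedge_shear[OF c(1)])
  qed
  ultimately have "0 < h (edge k)" if "k \<in> {1..n}" for k
    using turn_pos[OF that] by (metis less_eq_real_def mult_zero_right)
  then have h_pos: "0 < h (edge k)" if "k \<le> n" for k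
    using that edge_0 three_le by (cases "k = 0") auto
  obtain D where D: "compact D" "{v. h v \<le> 1} \<subseteq> D" "measure lborel D \<le> 2 * a * b"
    using diamond_cover[OF c(1) ab] unfolding h_def by blast
  have conv: "convex {v. h v \<le> 1}"
  proof (rule convexI)
    fix u v and x y :: real
    assume uv: "u \<in> {v. h v \<le> 1}" "v \<in> {v. h v \<le> 1}" "0 \<le> x" "0 \<le> y" "x + y = 1"
    have "h (x *\<^sub>R u + y *\<^sub>R v) \<le> x * h u + y * h v"
      using h_add[of "x *\<^sub>R u" "y *\<^sub>R v"] uv by (simp add: h_scale)
    also have "\<dots> \<le> x * 1 + y * 1"
      using uv by (intro add_mono mult_left_mono) auto
    finally show "x *\<^sub>R u + y *\<^sub>R v \<in> {v. h v \<le> 1}"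
      using uv by simp
  qed
  have unit: "h (edge k /\<^sub>R h (edge k)) = 1" if "k \<le> n" for k
    using h_pos[OF that] by (simp add: h_scale)
  have tri: "convex hull {0, edge (k - 1) /\<^sub>R h (edge (k - 1)), edge k /\<^sub>R h (edge k)} \<subseteq> D"
    if "k \<in> {1..n}" for k
  proof -
    have "h 0 = 0"
      by (simp add: h_def)
    then have "convex hull {0, edge (k - 1) /\<^sub>R h (edge (k - 1)), edge k /\<^sub>R h (edge k)} \<subseteq> {v. h v \<le> 1}"
      using unit[of k] unit[of "k - 1"] that by (intro hull_minimal conv) auto
    with D show ?thesis by blast
  qed
  define w where "w k = s * wedge (edge (k - 1)) (edge k)" for k
  have turns: "(\<Sum>k=1..n. w k / (h (edge (k - 1)) * h (edge k))) \<le> 4 * a * b"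
    using sum_normalized_turns_le[of h D] h_pos D tri unfolding w_def by force
  have "(\<Sum>k=1..n. h (edge k)) = (\<Sum>k=1..n. \<bar>e1 \<bullet> edge k\<bar>) / a + (\<Sum>k=1..n. \<bar>c \<bullet> edge k\<bar>) / b"
    by (simp add: h_def e1 sum.distrib sum_divide_distrib)
  also have "\<dots> \<le> (2 * (R$1 - L$1)) / a + (2 * (c \<bullet> T - c \<bullet> B)) / b"
    using ab L(2) R(2) B(2) T(2)
    by (intro add_mono divide_right_mono sum_abs_projection_le) (auto simp: e1)
  also have "\<dots> = 4"
    using ab by (simp add: a_def[symmetric] b_def[symmetric])
  finally have lengths: "(\<Sum>k=1..n. h (edge k)) \<le> 4" .
  have n: "0 < real n"
    using three_le by simp
  have "\<exists>k\<in>{1..n}. w k \<le> 64 * a * b / real n ^ 3"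
  proof (rule ccontr)
    assume *: "\<not> ?thesis"
    \<comment> \<open>Each factor is divided by the upper bound for its mean over all vertices: \<open>4 / n\<close> for
      the lengths and \<open>4 a b / n\<close> for the normalized turns.\<close>
    define x where "x k = h (edge (k - 1)) * n / 4" for k
    define y where "y k = h (edge k) * n / 4" for k
    define z where "z k = w k / (h (edge (k - 1)) * h (edge k)) * n / (4 * a * b)" for k
    have "3 < x k + y k + z k" if k: "k \<in> {1..n}" for k
    proof (rule prod3_gt_1_imp_sum3_gt_3)
      have hk: "0 < h (edge (k - 1))" "0 < h (edge k)"
        using h_pos k by auto
      have "0 < w k"
        using turn_pos[OF k] by (simp add: w_def)
      then show "0 < x k" "0 < y k" "0 < z k"
        using hk n ab by (auto simp: x_def y_def z_def)
      have "64 * a * b / real n ^ 3 < w k"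
        using * k by (meson not_le)
      then have "1 < w k * real n ^ 3 / (64 * a * b)"
        using n ab by (simp add: field_simps)
      also have "\<dots> = x k * y k * z k"
        using hk ab by (simp add: x_def y_def z_def field_simps power3_eq_cube)
      finally show "1 < x k * y k * z k" .
    qed
    then have "(\<Sum>k=1..n. 3) < (\<Sum>k=1..n. x k + y k + z k)"
      using three_le by (intro sum_strict_mono) auto
    also have "\<dots> = (\<Sum>k=1..n. x k) + (\<Sum>k=1..n. y k) + (\<Sum>k=1..n. z k)"
      by (simp add: sum.distrib)
    also have "(\<Sum>k=1..n. x k) = (\<Sum>k=1..n. y k)"
      unfolding x_def y_def by (rule sum_previous_edge)
    also have "(\<Sum>k=1..n. y k) = (\<Sum>k=1..n. h (edge k)) * n / 4"
      unfolding y_def by (simp add: sum_distrib_right sum_divide_distrib)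
    also have "\<dots> \<le> 4 * n / 4"
      using lengths n by (intro divide_right_mono mult_right_mono) auto
    also have "(\<Sum>k=1..n. z k) = (\<Sum>k=1..n. w k / (h (edge (k - 1)) * h (edge k))) * n / (4 * a * b)"
      unfolding z_def by (simp add: sum_distrib_right sum_divide_distrib)
    also have "\<dots> \<le> (4 * a * b) * n / (4 * a * b)"
      using turns ab n by (intro divide_right_mono mult_right_mono) auto
    finally show False
      using ab by simp
  qed
  then obtain k where k: "k \<in> {1..n}" "w k \<le> 64 * a * b / real n ^ 3"
    by blast
  have "measure lborel (convex hull {A (k - 1), A k, A (k + 1)}) = w k / 2"
    using ear_area[OF k(1)] by (simp add: w_def)
  also have "\<dots> \<le> 64 / real n ^ 3 * (a * b / 2)"
    using k(2) by (simp add: field_simps)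
  also have "\<dots> \<le> 64 / real n ^ 3 * measure lborel (convex hull ?V)"
    using area by (intro mult_left_mono) auto
  finally show ?thesis
    using k(1) by blast
qed

end

section \<open>Orientation of a convex polygon\<close>

text \<open>
  A face of a polytope is exposed, so some linear functional \<open>c\<close> attains its maximum on the polygon
  exactly at the edge. It vanishes on the edge vector, hence is proportional to the determinant with
  the edge vector. The inequality is strict because a vertex that lies on the edge is
  extreme there and so is one of its end points.
\<close>

lemma edge_supports_vertices:
  assumes poly: "convex_ngon n A" and k: "k \<in> {1..n}"
  obtains d where "d \<noteq> 0"
    "\<And>j. \<lbrakk>j \<in> {1..n}; A j \<noteq> A k; A j \<noteq> A (k + 1)\<rbrakk> \<Longrightarrow> 0 < d * wedge (A (k + 1) - A k) (A j - A k)"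
proof -
  let ?H = "convex hull (A ` {1..n})"
  let ?E = "closed_segment (A k) (A (k + 1))"
  have "?E edge_of ?H"
    using poly k by (simp add: convex_ngon_def)
  then have "?E face_of ?H" and dim: "aff_dim ?E = 1"
    by (auto simp: edge_of_def)
  moreover have "polyhedron ?H"
    by (intro polytope_imp_polyhedron polytope_convex_hull) simp
  ultimately have "?E exposed_face_of ?H"
    using exposed_face_of_polyhedron by blast
  then obtain c m where cm: "?H \<subseteq> {x. c \<bullet> x \<le> m}" "?E = ?H \<inter> {x. c \<bullet> x = m}"
    unfolding exposed_face_of_def by blast
  define e where "e = A (k + 1) - A k"
  have "e \<noteq> 0"
    using dim by (auto simp: e_def)
  have ends: "c \<bullet> A k = m" "c \<bullet> A (k + 1) = m"
  proof -
    have "A k \<in> ?E" "A (k + 1) \<in> ?E"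
      by simp_all
    then show "c \<bullet> A k = m" "c \<bullet> A (k + 1) = m"
      unfolding cm(2) by simp_all
  qed
  then have ce: "c \<bullet> e = 0"
    by (simp add: e_def inner_diff_right)
  have strict: "0 < - wedge e c * wedge e (A j - A k)"
    if j: "j \<in> {1..n}" "A j \<noteq> A k" "A j \<noteq> A (k + 1)" for j
  proof -
    have ext: "A j extreme_point_of ?H"
      using poly j by (auto simp: convex_ngon_def)
    have "A j \<in> ?H"
      using j by (simp add: hull_inc)
    have "A j \<notin> ?E"
    proof
      assume "A j \<in> ?E"
      then have "A j extreme_point_of ?E"
        using ext \<open>?E face_of ?H\<close> extreme_point_of_face by blast
      then show False
        using j by (simp add: extreme_point_of_segment)
    qed
    then have "c \<bullet> A j < m"
      using cm \<open>A j \<in> ?H\<close> by (metis (mono_tags, lifting) IntI less_eq_real_def mem_Collect_eq subsetD)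
    then have "c \<bullet> (A j - A k) < 0"
      using ends by (simp add: inner_diff_right)
    moreover have "(c \<bullet> (A j - A k)) * (e \<bullet> e) = wedge e c * wedge e (A j - A k) + (c \<bullet> e) * (e \<bullet> (A j - A k))"
      unfolding wedge_def inner_real2 by algebra
    moreover have "0 < e \<bullet> e"
      using \<open>e \<noteq> 0\<close> by simp
    ultimately have "wedge e c * wedge e (A j - A k) < 0"
      using ce by (metis add.right_neutral mult_neg_pos mult_zero_left)
    then show ?thesis by simp
  qed
  show ?thesis
  proof (cases "wedge e c = 0")
    case False
    then show ?thesis
      using that[of "- wedge e c"] strict unfolding e_def by simp
  next
    case True
    \<comment> \<open>Then \<open>strict\<close> shows that no vertex off the edge exists, so any \<open>d\<close> will do.\<close>
    then show ?thesis
      using that[of 1] strict unfolding e_def by fastforce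
  qed
qed

text \<open>
  A priori the side on which the vertices lie may depend on the edge. Two consecutive edges have
  the same side, as both sides are given by the orientation of the triangle that they span.
\<close>

lemma convex_ngon_oriented:
  assumes poly: "convex_ngon n A"
  obtains s where "oriented_polygon n A s"
proof -
  have n: "n \<ge> 3" and wrap: "A 0 = A n" "A (n + 1) = A 1" and inj: "inj_on A {1..n}"
    using poly by (auto simp: convex_ngon_def)
  define P where "P s k \<longleftrightarrow> (\<forall>j\<in>{1..n}. A j \<noteq> A k \<longrightarrow> A j \<noteq> A (k + 1) \<longrightarrow>
      0 < s * wedge (A (k + 1) - A k) (A j - A k))" for s :: real and k
  have ex: "\<exists>s. \<bar>s\<bar> = 1 \<and> P s k" if k: "k \<in> {1..n}" for k
  proof -
    obtain d where d: "d \<noteq> 0"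
      "\<And>j. \<lbrakk>j \<in> {1..n}; A j \<noteq> A k; A j \<noteq> A (k + 1)\<rbrakk> \<Longrightarrow> 0 < d * wedge (A (k + 1) - A k) (A j - A k)"
      using edge_supports_vertices[OF poly k] by blast
    have "P (sgn d) k"
      unfolding P_def using d by (auto simp: sgn_real_def zero_less_mult_iff split: if_splits)
    then show ?thesis
      using d(1) by (intro exI[of _ "sgn d"]) (simp add: abs_sgn_eq)
  qed
  obtain s where s: "\<bar>s\<bar> = 1" "P s 1"
    using ex[of 1] n by auto
  have "P s k" if "1 \<le> k" "k \<le> n" for k
    using that
  proof (induction k rule: dec_induct)
    case base
    show ?case by (rule s)
  next
    case (step k)
    obtain s' where s': "\<bar>s'\<bar> = 1" "P s' (Suc k)"
      using ex[of "Suc k"] step by auto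
    have "P s k"
      using step by simp
    \<comment> \<open>The successor of the vertex \<open>k + 1\<close>, as an index between \<open>1\<close> and \<open>n\<close>.\<close>
    define l where "l = (if k + 2 \<le> n then k + 2 else 1)"
    have l: "l \<in> {1..n}" "A l = A (Suc k + 1)"
    proof -
      have "k + 2 = n + 1" if "\<not> k + 2 \<le> n"
        using that step by simp
      then show "l \<in> {1..n}" "A l = A (Suc k + 1)"
        using n wrap by (auto simp: l_def)
    qed
    have ne: "A l \<noteq> A k" "A l \<noteq> A (k + 1)" "A k \<noteq> A (k + 1)"
      using l step n inj_onD[OF inj, of l k] inj_onD[OF inj, of l "k + 1"] inj_onD[OF inj, of k "k + 1"]
      by (auto simp: l_def split: if_splits)
    have "0 < s * wedge (A (k + 1) - A k) (A l - A k)"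
      using \<open>P s k\<close> l(1) ne unfolding P_def by blast
    moreover have "0 < s' * wedge (A l - A (k + 1)) (A k - A (k + 1))"
    proof -
      have "k \<in> {1..n}" "A k \<noteq> A (Suc k + 1)"
        using step l ne by auto
      then show ?thesis
        using s'(2) l(2) ne unfolding P_def Suc_eq_plus1 by metis
    qed
    moreover have "wedge (A l - A (k + 1)) (A k - A (k + 1)) = wedge (A (k + 1) - A k) (A l - A k)"
      unfolding wedge_def by (simp add: algebra_simps)
    ultimately have "0 < s * s'"
      by (smt (verit) zero_less_mult_iff mult_less_0_iff)
    then have "s = s'"
      using s(1) s'(1) by (auto simp: abs_if split: if_splits)
    with s' show ?case by simp
  qed
  then have "oriented_polygon n A s"
    using n wrap inj s(1) by unfold_locales (auto simp: P_def)
  then show ?thesis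
    using that by blast
qed

lemma min_ear_ratio_le:
  assumes "convex_ngon n A"
  shows "min_ear_ratio n A \<le> 64 / real n ^ 3"
proof -
  obtain s where "oriented_polygon n A s"
    using convex_ngon_oriented[OF assms] .
  then interpret oriented_polygon n A s .
  let ?H = "measure lborel (convex hull (A ` {1..n}))"
  obtain k where k: "k \<in> {1..n}"
    "measure lborel (convex hull {A (k - 1), A k, A (k + 1)}) \<le> 64 / real n ^ 3 * ?H"
    using exists_small_ear by blast
  have "min_ear_ratio n A \<le> measure lborel (convex hull {A (k - 1), A k, A (k + 1)}) / ?H"
    unfolding min_ear_ratio_def using k(1) by (intro Min_le) auto
  also have "\<dots> \<le> 64 / real n ^ 3"
    \<comment> \<open>If the area were \<open>0\<close>, the ratio would be \<open>0\<close>, the value of a division by \<open>0\<close>.\<close>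
  proof (cases "?H = 0")
    case False
    then have "0 < ?H"
      by (simp add: less_le)
    then show ?thesis
      using k(2) by (simp add: divide_le_eq)
  qed simp
  finally show ?thesis .
qed

theorem theorem4p4:
  fixes n :: nat
  assumes "n \<ge> 4"
  shows "g n \<le> 4 / real n * (sin (2 * pi / real n))\<^sup>2"
proof -
  have "4 / real n = 2 / pi * (2 * pi / real n)"
    by simp
  also have "\<dots> \<le> sin (2 * pi / real n)"
    using assms by (intro jordan_sin_ge) (auto simp: field_simps)
  finally have "(4 / real n)\<^sup>2 \<le> (sin (2 * pi / real n))\<^sup>2"
    by (intro power_mono) auto
  then have "4 / real n * (4 / real n)\<^sup>2 \<le> 4 / real n * (sin (2 * pi / real n))\<^sup>2"
    by (intro mult_left_mono) auto
  moreover have "64 / real n ^ 3 = 4 / real n * (4 / real n)\<^sup>2"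
    by (simp add: power2_eq_square power3_eq_cube)
  ultimately have bound: "64 / real n ^ 3 \<le> 4 / real n * (sin (2 * pi / real n))\<^sup>2"
    by simp
  show ?thesis
    unfolding g_def
  proof (rule cSUP_least)
    show "{A. convex_ngon n A} \<noteq> {}"
      using convex_ngon_parabola_polygon[of n] assms by auto
    show "min_ear_ratio n A \<le> 4 / real n * (sin (2 * pi / real n))\<^sup>2" if "A \<in> {A. convex_ngon n A}" for A
      using min_ear_ratio_le[of n A] that bound by simp
  qed
qed

end
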